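(* The union of all primitive, abbreviated, ordered configuration chains is equal to $X$ (as directed graphs whose vertices are identified with their labels in $\mathbb{Z}^3$).
   Context: Define $\tau_0([a,b,c])=[a,c,a+c]$ and $\tau_1([a,b,c])=[b,c,b+c]$. $X$ is the infinite directed rooted binary tree whose root is labelled $[1,2,3]$ and in which every vertex labelled $\mathbf{s}$ has two out-edges, leading to vertices labelled $\tau_0(\mathbf{s})$ and $\tau_1(\mathbf{s})$. A three hat configuration is a triple of positive integers one of which is the sum of the other two. An ordered configuration is a three hat configuration written as $[a,b,c]$ with $a\le b\le c$ (so $a+b=c$). A configuration is primitive if its entries are pairwise coprime. A base configuration is one in which two entries are equal; the only primitive ordered base configuration is $[1,1,2]$. The reduction of a non-base configuration replaces its largest entry by the absolute difference of the two smaller entries. The ordered configuration chain of a configuration is the sequence obtained by applying the reduction repeatedly until a base configuration is reached, with each configuration rewritten as an ordered configuration; it is primitive if its configurations are primitive. An ordered configuration chain is viewed as a directed linear graph (path), with one vertex labelled by each configuration in the chain, with edges directed away from the base configuration. A chain is abbreviated if the base configuration $[1,1,2]$ is omitted from it. The union of such chains $C_i$ is the directed graph with vertex set $\bigcup_i V(C_i)$ (vertices with the same label being identified) and containing each $C_i$ as a subgraph (its edges are those of the $C_i$), each vertex other than $[1,2,3]$ having indegree one. *)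

theory Defs
  imports Graph_Theory.Pair_Digraph
begin

type_synonym triple = "int \<times> int \<times> int"

fun three_hat :: "triple \<Rightarrow> bool" where
  "three_hat (a, b, c) \<longleftrightarrow>
     0 < a \<and> 0 < b \<and> 0 < c \<and> (a = b + c \<or> b = a + c \<or> c = a + b)"

fun primitive :: "triple \<Rightarrow> bool" where
  "primitive (a, b, c) \<longleftrightarrow> coprime a b \<and> coprime a c \<and> coprime b c"

fun base :: "triple \<Rightarrow> bool" where
  "base (a, b, c) \<longleftrightarrow> a = b \<or> a = c \<or> b = c"

fun ordered_form :: "triple \<Rightarrow> triple" where
  "ordered_form (a, b, c) = (case sort [a, b, c] of [x, y, z] \<Rightarrow> (x, y, z))"

fun reduction :: "triple \<Rightarrow> triple" where
  "reduction (a, b, c) =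
     (if a \<le> c \<and> b \<le> c then (a, b, \<bar>a - b\<bar>)
      else if a \<le> b \<and> c \<le> b then (a, \<bar>a - c\<bar>, c)
      else (\<bar>b - c\<bar>, b, c))"

text \<open>The ordered configuration chain of \<open>s\<close>, listed from \<open>s\<close> down to its base configuration.
  It is only meaningful if \<open>three_hat s\<close> holds; that condition is tested merely to make the
  recursion total.\<close>

function chain :: "triple \<Rightarrow> triple list" where
  "chain s =
     (if three_hat s \<and> \<not> base s then ordered_form s # chain (reduction s)
      else [ordered_form s])"
  by auto
termination
  by (relation "measure (\<lambda>(a, b, c). nat (a + b + c))") auto

declare chain.simps [simp del]

definition abbreviate :: "triple list \<Rightarrow> triple list" where
  "abbreviate C = removeAll (1, 1, 2) C"

text \<open>Edges are directed away from the base configuration, hence from the end of the list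
  towards its head.\<close>

definition path_graph :: "triple list \<Rightarrow> triple pair_pre_digraph" where
  "path_graph C =
     \<lparr> pverts = set C, parcs = {(C ! Suc i, C ! i) | i. Suc i < length C} \<rparr>"

definition union_graph :: "'a pair_pre_digraph set \<Rightarrow> 'a pair_pre_digraph" where
  "union_graph \<G> = \<lparr> pverts = (\<Union>G\<in>\<G>. pverts G), parcs = (\<Union>G\<in>\<G>. parcs G) \<rparr>"

definition primitive_chain_union :: "triple pair_pre_digraph" where
  "primitive_chain_union =
     union_graph {path_graph (abbreviate (chain s)) | s.
                    three_hat s \<and> (\<forall>t\<in>set (chain s). primitive t)}"

fun tau0 :: "triple \<Rightarrow> triple" where
  "tau0 (a, b, c) = (a, c, a + c)"

fun tau1 :: "triple \<Rightarrow> triple" where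
  "tau1 (a, b, c) = (b, c, b + c)"

text \<open>The vertices of the infinite binary tree are the finite binary words, with the most recent
  branching at the head of the word; the root is the empty word.\<close>

definition X_tree :: "bool list pair_pre_digraph" where
  "X_tree = \<lparr> pverts = UNIV, parcs = {(w, i # w) | w i. True} \<rparr>"

fun X_label :: "bool list \<Rightarrow> triple" where
  "X_label [] = (1, 2, 3)"
| "X_label (i # w) = (if i then tau1 (X_label w) else tau0 (X_label w))"

text \<open>Replacing vertices by their labels is an isomorphism onto the result exactly if the labelling
  is injective on the vertices.\<close>

definition relabel :: "('a \<Rightarrow> 'b) \<Rightarrow> 'a pair_pre_digraph \<Rightarrow> 'b pair_pre_digraph" where
  "relabel f G = \<lparr> pverts = f ` pverts G, parcs = map_prod f f ` parcs G \<rparr>"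

end

theory Submission
  imports Defs
begin

text \<open>An ordered non-base configuration \<open>(a, b, a + b)\<close>, \<open>0 < a < b\<close>, has exactly one predecessor in
  its chain, namely the sorted version of \<open>(a, b, b - a)\<close>, and the two maps \<open>\<tau>\<^sub>0\<close>, \<open>\<tau>\<^sub>1\<close> are the two
  ways of undoing this step: \<open>\<tau>\<^sub>0\<close> if \<open>b > 2 a\<close>, \<open>\<tau>\<^sub>1\<close> if \<open>b < 2 a\<close>. The remaining case \<open>b = 2 a\<close>
  is the one in which the predecessor is a base configuration, and coprimality then forces
  \<open>(1, 2, 3)\<close>. So both graphs have as vertices all primitive ordered non-base configurations, and as
  arcs all pairs of such a configuration and one of its two images.

  For the tree, the vertices are found by descent on the largest entry
  (\<open>range_X_label\<close>), and the comparison of \<open>b\<close> with \<open>2 a\<close> makes the labels distinct and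
  the parents unique (\<open>child_injective\<close>). For the chains, one inclusion is an induction along
  the chain (\<open>chain_graph_subset\<close>), which rests on the fact that reducing and then sorting is inverse
  to one of the \<open>\<tau>\<close>s (\<open>ordered_form_eq_child_reduction\<close>). The other holds because the chain of a
  configuration exhibits that configuration, and the chain of \<open>\<tau>\<^sub>i(v)\<close> begins
  with \<open>\<tau>\<^sub>i(v)\<close> and \<open>v\<close>.\<close>

definition child :: "bool \<Rightarrow> triple \<Rightarrow> triple" where
  "child i v = (if i then tau1 v else tau0 v)"

text \<open>The primitive ordered configurations other than \<open>(1, 1, 2)\<close>. The third entry is determined by the
  other two, so coprimality of the first two already gives pairwise coprimality.\<close>

definition prim_configs :: "triple set" where
  "prim_configs = {(a, b, c). 0 < a \<and> a < b \<and> c = a + b \<and> coprime a b}"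

definition child_arcs :: "(triple \<times> triple) set" where
  "child_arcs = {(v, child i v) | v i. v \<in> prim_configs}"

lemma child_arcI: "v \<in> prim_configs \<Longrightarrow> (v, child i v) \<in> child_arcs"
  unfolding child_arcs_def by blast

section \<open>The labelled tree\<close>

lemma X_label_Cons: "X_label (i # w) = child i (X_label w)"
  by (simp add: child_def)

lemma root_in_prim_configs: "(1, 2, 3) \<in> prim_configs"
  by (simp add: prim_configs_def)

lemma coprime_add_iffs:
  fixes a b :: int
  shows "coprime a (a + b) \<longleftrightarrow> coprime a b" "coprime b (a + b) \<longleftrightarrow> coprime a b"
  by (simp_all add: coprime_iff_gcd_eq_1 gcd.commute[of b])

lemma child_in_prim_configs:
  assumes "v \<in> prim_configs"
  shows "child i v \<in> prim_configs"
  using assms by (auto simp: prim_configs_def child_def coprime_add_iffs)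

text \<open>For \<open>(a, b, a + b)\<close> with \<open>0 < a < b\<close>, the second entry of the image under \<open>\<tau>\<^sub>0\<close> is more than twice
  the first, and under \<open>\<tau>\<^sub>1\<close> less than twice the first. Hence the index is visible in the image; the
  entries of the preimage are then read off.\<close>

lemma child_injective:
  assumes "u \<in> prim_configs" "v \<in> prim_configs" "child i u = child j v"
  shows "i = j \<and> u = v"
  using assms by (auto simp: prim_configs_def child_def split: if_splits)

text \<open>The same comparison separates the root, where the second entry is exactly twice the first.\<close>

lemma child_neq_root:
  assumes "v \<in> prim_configs"
  shows "child i v \<noteq> (1, 2, 3)"
  using assms by (auto simp: prim_configs_def child_def)

text \<open>Undoing \<open>\<tau>\<^sub>0\<close> or \<open>\<tau>\<^sub>1\<close> according to the comparison of \<open>b\<close> with \<open>2 a\<close>.\<close>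

lemma prim_configs_cases:
  assumes "v \<in> prim_configs"
  obtains (root) "v = (1, 2, 3)"
  | (child) i u where "u \<in> prim_configs" "v = child i u" "snd (snd u) < snd (snd v)"
proof -
  obtain a b where v: "v = (a, b, a + b)" and ab: "0 < a" "a < b" "coprime a b"
    using assms by (auto simp: prim_configs_def)
  have cop: "coprime a (b - a)"
    using ab(3) coprime_add_iffs(1)[of a "b - a"] by simp
  consider "b = 2 * a" | "b < 2 * a" | "2 * a < b" by linarith
  then show thesis
  proof cases
    case 1
    then have "a = 1" using ab by simp
    then show thesis using 1 v root by simp
  next
    case 2
    then have "(b - a, a, b) \<in> prim_configs"
      using ab cop by (simp add: prim_configs_def coprime_commute)
    then show thesis using child[of "(b - a, a, b)" True] v ab by (simp add: child_def)
  next
    case 3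
    then have "(a, b - a, b) \<in> prim_configs"
      using ab cop by (simp add: prim_configs_def)
    then show thesis using child[of "(a, b - a, b)" False] v ab by (simp add: child_def)
  qed
qed

lemma X_label_in_prim_configs: "X_label w \<in> prim_configs"
  by (induction w)
    (simp_all add: X_label_Cons root_in_prim_configs child_in_prim_configs del: X_label.simps(2))

text \<open>Surjectivity is by descent: passing to the parent decreases the largest entry.\<close>

lemma range_X_label: "range X_label = prim_configs"
proof
  show "range X_label \<subseteq> prim_configs" using X_label_in_prim_configs by blast
next
  have "v \<in> range X_label" if "v \<in> prim_configs" for v
    using that
  proof (induction "nat (snd (snd v))" arbitrary: v rule: less_induct)
    case less
    from less.prems show ?case
    proof (cases rule: prim_configs_cases)
      case root
      then show ?thesis by (metis X_label.simps(1) rangeI)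
    next
      case (child i u)
      then have "0 < snd (snd v)" using less.prems by (auto simp: prim_configs_def)
      then have "u \<in> range X_label" using less.hyps child by simp
      then show ?thesis using child(2) X_label_Cons by (metis imageE rangeI)
    qed
  qed
  then show "prim_configs \<subseteq> range X_label" by blast
qed

lemma inj_X_label: "inj X_label"
proof (rule injI)
  fix w w' assume "X_label w = X_label w'"
  then show "w = w'"
  proof (induction w arbitrary: w')
    case Nil
    then show ?case
      using child_neq_root[OF X_label_in_prim_configs]
      by (cases w') (metis X_label.simps(1) X_label_Cons)+
  next
    case (Cons i w)
    then show ?case
    proof (cases w')
      case Nil
      then show ?thesis
        using Cons.prems child_neq_root[OF X_label_in_prim_configs]
        by (metis X_label.simps(1) X_label_Cons)
    next
      case w': (Cons j w'')
      then have "i = j \<and> X_label w = X_label w''"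
        using Cons.prems child_injective[OF X_label_in_prim_configs X_label_in_prim_configs]
        by (simp only: X_label_Cons)
      then show ?thesis using Cons.IH w' by blast
    qed
  qed
qed

lemma relabel_X_tree:
  "relabel X_label X_tree = \<lparr> pverts = prim_configs, parcs = child_arcs \<rparr>"
proof -
  have "map_prod X_label X_label ` {(w, i # w) | w i. True} =
        {(v, child i v) | v i. v \<in> range X_label}"
    by (force simp: X_label_Cons image_iff simp del: X_label.simps(2))
  then show ?thesis
    by (simp add: relabel_def X_tree_def child_arcs_def range_X_label)
qed

section \<open>Reduction and sorting\<close>

lemma three_hat_reduction:
  assumes "three_hat s" "\<not> base s"
  shows "three_hat (reduction s)"
  using assms by (cases s) auto

text \<open>Reduction may be applied to an unsorted triple; after sorting, the result is still a
  preimage of the sorted triple under one of \<open>\<tau>\<^sub>0\<close>, \<open>\<tau>\<^sub>1\<close>.\<close>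

lemma ordered_form_eq_child_reduction:
  assumes "three_hat s" "\<not> base s"
  obtains i where "ordered_form s = child i (ordered_form (reduction s))"
proof -
  have "ordered_form s = tau0 (ordered_form (reduction s)) \<or>
        ordered_form s = tau1 (ordered_form (reduction s))"
    using assms by (cases s) (auto simp: abs_if)
  then show thesis
    using that[of True] that[of False] by (auto simp: child_def)
qed

lemma primitive_ordered_form: "primitive (ordered_form s) \<longleftrightarrow> primitive s"
  by (cases s) (auto simp: coprime_commute)

lemma coprime_diff_iffs:
  fixes a b :: int
  shows "coprime a (b - a) \<longleftrightarrow> coprime a b" "coprime a (a - b) \<longleftrightarrow> coprime a b"
  using coprime_add_iffs[of a "b - a"] coprime_minus_right_iff[of a "b - a"] by simp_all

lemma primitive_reduction:
  assumes "three_hat s" "primitive s"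
  shows "primitive (reduction s)"
  using assms
  by (cases s) (auto simp: abs_if coprime_diff_iffs; simp add: coprime_diff_iffs coprime_commute)

lemma ordered_form_in_prim_configs:
  assumes "three_hat s" "\<not> base s" "primitive s"
  shows "ordered_form s \<in> prim_configs"
  using assms by (cases s) (auto simp: prim_configs_def coprime_commute)

text \<open>Two equal entries that are coprime are both 1.\<close>

lemma ordered_form_primitive_base:
  assumes "three_hat s" "base s" "primitive s"
  shows "ordered_form s = (1, 1, 2)"
  using assms by (cases s) auto

section \<open>Chains as graphs\<close>

lemma chain_nonbase:
  assumes "three_hat s" "\<not> base s"
  shows "chain s = ordered_form s # chain (reduction s)"
  using assms by (simp add: chain.simps[of s])

lemma chain_base:
  assumes "base s"
  shows "chain s = [ordered_form s]"
  using assms by (simp add: chain.simps[of s])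

lemma chain_eq_Cons: "\<exists>xs. chain s = ordered_form s # xs"
  by (simp add: chain.simps[of s])

lemma chain_primitive:
  assumes "three_hat s" "primitive s" "t \<in> set (chain s)"
  shows "primitive t"
  using assms
proof (induction s rule: chain.induct)
  case (1 s)
  then show ?case
    by (cases "base s")
      (auto simp: chain_base chain_nonbase primitive_ordered_form
        simp del: reduction.simps ordered_form.simps
        intro: three_hat_reduction primitive_reduction)
qed

lemma primitive_if_chain_primitive:
  assumes "\<forall>t\<in>set (chain s). primitive t"
  shows "primitive s"
  using assms chain_eq_Cons[of s] primitive_ordered_form[of s] by auto

lemma pverts_path_graph [simp]: "pverts (path_graph C) = set C"
  by (simp add: path_graph_def)

lemma parcs_path_graph_Cons_Cons:
  "parcs (path_graph (x # y # C)) = insert (y, x) (parcs (path_graph (y # C)))"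
proof -
  have ex_nat_cases: "(\<exists>i. P i) \<longleftrightarrow> P 0 \<or> (\<exists>i. P (Suc i))" for P :: "nat \<Rightarrow> bool"
    by (metis not0_implies_Suc)
  have "(\<exists>i. p = ((x # y # C) ! Suc i, (x # y # C) ! i) \<and> Suc i < length (x # y # C)) \<longleftrightarrow>
        p = (y, x) \<or> (\<exists>i. p = ((y # C) ! Suc i, (y # C) ! i) \<and> Suc i < length (y # C))" for p
    by (subst ex_nat_cases) simp
  then show ?thesis by (auto simp: path_graph_def)
qed

lemma parcs_path_graph_short: "length C \<le> 1 \<Longrightarrow> parcs (path_graph C) = {}"
  by (auto simp: path_graph_def)

lemma base_not_in_prim_configs: "(1, 1, 2) \<notin> prim_configs"
  by (simp add: prim_configs_def)

lemma abbreviate_chain_base: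
  assumes "three_hat s" "base s" "primitive s"
  shows "abbreviate (chain s) = []"
  using ordered_form_primitive_base[OF assms] chain_base[OF assms(2)]
  by (simp add: abbreviate_def)

lemma abbreviate_chain_nonbase:
  assumes "three_hat s" "\<not> base s" "primitive s"
  shows "abbreviate (chain s) = ordered_form s # abbreviate (chain (reduction s))"
  using ordered_form_in_prim_configs[OF assms] chain_nonbase[OF assms(1,2)] base_not_in_prim_configs
  by (auto simp: abbreviate_def)

lemma abbreviate_chain_eq_Cons:
  assumes "three_hat s" "\<not> base s" "primitive s"
  shows "\<exists>xs. abbreviate (chain s) = ordered_form s # xs"
  using abbreviate_chain_nonbase[OF assms] by blast

text \<open>Each step of the chain contributes one arc, which is an arc of the tree unless it ends the chain:
  the last step is the arc from \<open>(1, 1, 2)\<close> to the root, and abbreviating removes it.\<close>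

lemma chain_graph_subset:
  assumes "three_hat s" "primitive s"
  shows "pverts (path_graph (abbreviate (chain s))) \<subseteq> prim_configs \<and>
         parcs (path_graph (abbreviate (chain s))) \<subseteq> child_arcs"
  using assms
proof (induction s rule: chain.induct)
  case (1 s)
  show ?case
  proof (cases "base s")
    case True
    then show ?thesis
      using 1 abbreviate_chain_base by (simp add: parcs_path_graph_short)
  next
    case False
    let ?r = "reduction s"
    have r: "three_hat ?r" "primitive ?r"
      using 1 False three_hat_reduction primitive_reduction by blast+
    have IH: "set (abbreviate (chain ?r)) \<subseteq> prim_configs"
      "parcs (path_graph (abbreviate (chain ?r))) \<subseteq> child_arcs"
      using 1 False r by auto
    have s: "ordered_form s \<in> prim_configs"
      using 1 False ordered_form_in_prim_configs by blast
    have eq: "abbreviate (chain s) = ordered_form s # abbreviate (chain ?r)"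
      using 1 False abbreviate_chain_nonbase by blast
    show ?thesis
    proof (cases "base ?r")
      case True
      then show ?thesis
        using eq s abbreviate_chain_base r by (simp add: parcs_path_graph_short)
    next
      case nonbase: False
      obtain xs where xs: "abbreviate (chain ?r) = ordered_form ?r # xs"
        using abbreviate_chain_eq_Cons[OF r(1) nonbase r(2)] by blast
      obtain i where "ordered_form s = child i (ordered_form ?r)"
        using ordered_form_eq_child_reduction 1 False by blast
      then have "(ordered_form ?r, ordered_form s) \<in> child_arcs"
        using ordered_form_in_prim_configs[OF r(1) nonbase r(2)]
        by (metis child_arcI)
      then show ?thesis
        using eq xs s IH parcs_path_graph_Cons_Cons by simp
    qed
  qed
qed

lemma prim_configs_ordered:
  assumes "v \<in> prim_configs"
  shows "three_hat v" "\<not> base v" "primitive v" "ordered_form v = v"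
  using assms by (auto simp: prim_configs_def coprime_add_iffs)

text \<open>Reducing a child returns the parent's entries in another order, so
  the chain of a child continues with its parent.\<close>

lemma reduction_child:
  assumes "v \<in> prim_configs"
  shows "\<not> base (reduction (child i v))" "ordered_form (reduction (child i v)) = v"
  using assms by (auto simp: prim_configs_def child_def)

lemma prim_config_in_own_chain:
  assumes "v \<in> prim_configs"
  shows "v \<in> pverts (path_graph (abbreviate (chain v)))"
  using abbreviate_chain_nonbase[of v] prim_configs_ordered[OF assms] by simp

lemma child_arc_in_chain_of_child:
  assumes "v \<in> prim_configs"
  shows "(v, child i v) \<in> parcs (path_graph (abbreviate (chain (child i v))))"
proof -
  let ?w = "child i v"
  have w: "three_hat ?w" "\<not> base ?w" "primitive ?w" "ordered_form ?w = ?w"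
    using prim_configs_ordered child_in_prim_configs[OF assms] by blast+
  obtain xs where "abbreviate (chain (reduction ?w)) = v # xs"
    using abbreviate_chain_eq_Cons three_hat_reduction[OF w(1,2)] primitive_reduction[OF w(1,3)]
      reduction_child[OF assms] by metis
  then have "abbreviate (chain ?w) = ?w # v # xs"
    using abbreviate_chain_nonbase[OF w(1-3)] w(4) by simp
  then show ?thesis by (simp add: parcs_path_graph_Cons_Cons)
qed

lemma primitive_chain_union_eq:
  "primitive_chain_union = \<lparr> pverts = prim_configs, parcs = child_arcs \<rparr>"
proof -
  let ?G = "\<lambda>s. path_graph (abbreviate (chain s))"
  let ?S = "{s. three_hat s \<and> primitive s}"
  have "(three_hat s \<and> (\<forall>t\<in>set (chain s). primitive t)) \<longleftrightarrow> s \<in> ?S" for s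
    using chain_primitive primitive_if_chain_primitive by blast
  then have "primitive_chain_union = union_graph (?G ` ?S)"
    unfolding primitive_chain_union_def by (simp only: setcompr_eq_image mem_Collect_eq)
  moreover have "(\<Union>s\<in>?S. pverts (?G s)) = prim_configs"
  proof
    show "(\<Union>s\<in>?S. pverts (?G s)) \<subseteq> prim_configs" using chain_graph_subset by blast
    show "prim_configs \<subseteq> (\<Union>s\<in>?S. pverts (?G s))"
      using prim_config_in_own_chain prim_configs_ordered by blast
  qed
  moreover have "(\<Union>s\<in>?S. parcs (?G s)) = child_arcs"
  proof
    show "(\<Union>s\<in>?S. parcs (?G s)) \<subseteq> child_arcs" using chain_graph_subset by blast
    show "child_arcs \<subseteq> (\<Union>s\<in>?S. parcs (?G s))"
    proof
      fix e assume "e \<in> child_arcs"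
      then obtain v i where v: "v \<in> prim_configs" "e = (v, child i v)"
        by (auto simp: child_arcs_def)
      then have "child i v \<in> ?S"
        using child_in_prim_configs prim_configs_ordered by blast
      then show "e \<in> (\<Union>s\<in>?S. parcs (?G s))"
        using child_arc_in_chain_of_child v by blast
    qed
  qed
  ultimately show ?thesis by (simp add: union_graph_def)
qed

section \<open>The union of the chains is the tree\<close>

lemma in_degree_prim_config:
  assumes "v \<in> prim_configs" "v \<noteq> (1, 2, 3)"
  shows "in_degree (with_proj \<lparr> pverts = prim_configs, parcs = child_arcs \<rparr>) v = 1"
proof -
  obtain i u where u: "u \<in> prim_configs" "v = child i u"
    using assms prim_configs_cases by metis
  have "e = (u, v)" if e: "e \<in> child_arcs" "snd e = v" for e
  proof -
    obtain j u' where "u' \<in> prim_configs" "e = (u', child j u')"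
      using e(1) unfolding child_arcs_def by blast
    then show ?thesis using child_injective[of u' u j i] u e(2) by simp
  qed
  then have "{e \<in> child_arcs. snd e = v} = {(u, v)}"
    using child_arcI[OF u(1)] u(2) by auto
  then show ?thesis by (simp add: in_degree_def in_arcs_def)
qed

theorem proposition5p1:
  shows "inj_on X_label (pverts X_tree)
    \<and> primitive_chain_union = relabel X_label X_tree
    \<and> (\<forall>v\<in>pverts primitive_chain_union - {(1, 2, 3)}.
         in_degree (with_proj primitive_chain_union) v = 1)"
proof (intro conjI ballI)
  show "inj_on X_label (pverts X_tree)"
    using inj_X_label by (simp add: X_tree_def)
  show "primitive_chain_union = relabel X_label X_tree"
    unfolding relabel_X_tree primitive_chain_union_eq ..
  fix v assume "v \<in> pverts primitive_chain_union - {(1, 2, 3)}"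
  then show "in_degree (with_proj primitive_chain_union) v = 1"
    unfolding primitive_chain_union_eq by (intro in_degree_prim_config) simp_all
qed

end
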